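(* If a $C^2$ regular lightlike curve $\alpha:I\to\mathbb{E}_1^3$ lies on a pseudo-sphere $\mathbb{S}_1^2(P;r)$, $r>0$, or on a light-cone $\mathcal{C}^2(P)$, then $\kappa_1=0$ or, equivalently, $\alpha$ is a straight line (i.e. its image is contained in a straight line).
   Context: $\mathbb{E}_1^3$ is $\mathbb{R}^3$ with the index 1 inner product $\langle x,y\rangle_1=x_1y_1+x_2y_2-x_3y_3$. A curve is lightlike if $\langle\alpha',\alpha'\rangle_1=0$ and $\alpha'\neq0$. $\mathbb{S}_1^2(P;r)=\{x:\langle x-P,x-P\rangle_1=r^2\}$, $\mathcal{C}^2(P)=\{x:\langle x-P,x-P\rangle_1=0\}$. Null frame: let $\mathbf t=\alpha'$, let $\mathbf z_1$ be a unit spacelike vector field along $\alpha$ with $\langle\mathbf t,\mathbf z_1\rangle_1=0$, and let $\mathbf z_2$ be the lightlike vector field with $\langle\mathbf z_1,\mathbf z_2\rangle_1=0$ and $\langle\mathbf t,\mathbf z_2\rangle_1=-1$. Then $\mathbf t'=\kappa_3\mathbf t+\kappa_1\mathbf z_1$, $\mathbf z_1'=-\kappa_2\mathbf t+\kappa_1\mathbf z_2$, $\mathbf z_2'=-\kappa_2\mathbf z_1-\kappa_3\mathbf z_2$, where $\kappa_1=\langle\mathbf t',\mathbf z_1\rangle_1$. *)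

theory Defs
  imports "HOL-Analysis.Analysis"
begin

definition lorentz_inner :: "real ^ 3 \<Rightarrow> real ^ 3 \<Rightarrow> real" (infix "\<bullet>\<^sub>1" 70) where
  "x \<bullet>\<^sub>1 y = x $ 1 * y $ 1 + x $ 2 * y $ 2 - x $ 3 * y $ 3"

definition lightlike_vector :: "real ^ 3 \<Rightarrow> bool" where
  "lightlike_vector x \<longleftrightarrow> x \<bullet>\<^sub>1 x = 0 \<and> x \<noteq> 0"

definition pseudo_sphere :: "real ^ 3 \<Rightarrow> real \<Rightarrow> (real ^ 3) set" where
  "pseudo_sphere P r = {x. (x - P) \<bullet>\<^sub>1 (x - P) = r\<^sup>2}"

definition light_cone :: "real ^ 3 \<Rightarrow> (real ^ 3) set" where
  "light_cone P = {x. (x - P) \<bullet>\<^sub>1 (x - P) = 0}"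

text \<open>
  A parameter interval is any interval with more than one point: open, closed or half-open,
  bounded or unbounded. Derivatives are taken within it, hence are one-sided at endpoints that
  belong to it and ordinary two-sided derivatives at interior points.
\<close>

definition param_interval :: "real set \<Rightarrow> bool" where
  "param_interval I \<longleftrightarrow> is_interval I \<and> interior I \<noteq> {}"

definition velocity :: "real set \<Rightarrow> (real \<Rightarrow> 'a::real_normed_vector) \<Rightarrow> real \<Rightarrow> 'a" where
  "velocity I f s = vector_derivative f (at s within I)"

definition C1_on :: "real set \<Rightarrow> (real \<Rightarrow> 'a::real_normed_vector) \<Rightarrow> bool" where
  "C1_on I f \<longleftrightarrow> f differentiable_on I \<and> continuous_on I (velocity I f)"

definition C2_on :: "real set \<Rightarrow> (real \<Rightarrow> 'a::real_normed_vector) \<Rightarrow> bool" where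
  "C2_on I f \<longleftrightarrow> C1_on I f \<and> C1_on I (velocity I f)"

text \<open>Regularity is part of the definition, since lightlike vectors are nonzero.\<close>

definition lightlike_curve :: "real set \<Rightarrow> (real \<Rightarrow> real ^ 3) \<Rightarrow> bool" where
  "lightlike_curve I \<alpha> \<longleftrightarrow> (\<forall>s\<in>I. lightlike_vector (velocity I \<alpha> s))"

definition null_frame ::
  "real set \<Rightarrow> (real \<Rightarrow> real ^ 3) \<Rightarrow> (real \<Rightarrow> real ^ 3) \<Rightarrow> (real \<Rightarrow> real ^ 3) \<Rightarrow> bool" where
  "null_frame I \<alpha> z1 z2 \<longleftrightarrow> C1_on I z1 \<and> C1_on I z2 \<and>
     (\<forall>s\<in>I. z1 s \<bullet>\<^sub>1 z1 s = 1 \<and> velocity I \<alpha> s \<bullet>\<^sub>1 z1 s = 0 \<and>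
            lightlike_vector (z2 s) \<and> z1 s \<bullet>\<^sub>1 z2 s = 0 \<and> velocity I \<alpha> s \<bullet>\<^sub>1 z2 s = -1)"

definition kappa1 :: "real set \<Rightarrow> (real \<Rightarrow> real ^ 3) \<Rightarrow> (real \<Rightarrow> real ^ 3) \<Rightarrow> real \<Rightarrow> real" where
  "kappa1 I \<alpha> z1 s = velocity I (velocity I \<alpha>) s \<bullet>\<^sub>1 z1 s"

definition in_straight_line :: "'a::real_vector set \<Rightarrow> bool" where
  "in_straight_line S \<longleftrightarrow> (\<exists>p v. v \<noteq> 0 \<and> S \<subseteq> {p + c *\<^sub>R v | c. True})"

end

theory Submission
  imports Defs
begin

text \<open>
  Write \<open>T = \<alpha>'\<close> and \<open>A = \<alpha>''\<close>. All three conditions in play - vanishing of \<open>\<kappa>\<^sub>1\<close>, straightness,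
  and lying on one of the two quadrics - are compared with the single condition that \<open>T\<close> and \<open>A\<close>
  are parallel, expressed by the Euclidean cross product as \<open>T \<times> A = 0\<close>.

  What links them is the degeneracy of the Lorentzian form on the plane \<open>T\<^sup>\<bottom>\<close> of a lightlike \<open>T\<close>:
  there it is, up to a positive factor, the square of the linear form \<open>w \<mapsto> (T \<times> w)\<^sub>3\<close>, whose kernel
  in \<open>T\<^sup>\<bottom>\<close> is the line spanned by \<open>T\<close> (\<open>lorentz_inner_rank_one\<close>, \<open>cross3_zero_iff_component_3\<close>).
  So a vector of \<open>T\<^sup>\<bottom>\<close> that is orthogonal to a spacelike vector of \<open>T\<^sup>\<bottom>\<close>, or to itself, is a
  multiple of \<open>T\<close>. The acceleration \<open>A\<close> lies in \<open>T\<^sup>\<bottom>\<close> because \<open>\<langle>T,T\<rangle>\<^sub>1\<close> is constant. Taking \<open>z1\<close>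
  for the spacelike vector gives \<open>\<kappa>\<^sub>1 = 0 \<longleftrightarrow> T \<times> A = 0\<close>.

  If \<open>\<langle>\<alpha> - P, \<alpha> - P\<rangle>\<^sub>1\<close> is constant, two differentiations give \<open>\<langle>T, \<alpha> - P\<rangle>\<^sub>1 = 0\<close> and
  \<open>\<langle>A, \<alpha> - P\<rangle>\<^sub>1 = -\<langle>T,T\<rangle>\<^sub>1 = 0\<close>. On a pseudo-sphere \<open>\<alpha> - P\<close> is spacelike and serves in place of
  \<open>z1\<close>. On a light-cone \<open>\<alpha> - P\<close> is itself parallel to \<open>T\<close>, and differentiating
  \<open>(\<alpha> - P) \<times> T = 0\<close> gives \<open>(\<alpha> - P) \<times> A = 0\<close>, hence \<open>T \<times> A = 0\<close> away from the vertex; the curve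
  cannot stay at the vertex, so continuity covers the remaining parameters.

  Finally \<open>T \<times> A = 0\<close> says that the direction of \<open>T\<close> is stationary, so it is equivalent to
  straightness.
\<close>

section \<open>The plane orthogonal to a lightlike vector\<close>

lemma bounded_bilinear_lorentz_inner: "bounded_bilinear (\<bullet>\<^sub>1)"
  unfolding bilinear_conv_bounded_bilinear[symmetric] bilinear_def
  by (auto intro!: linearI simp: lorentz_inner_def algebra_simps)

lemma bounded_bilinear_cross3: "bounded_bilinear cross3"
  using bilinear_cross by (simp add: bilinear_conv_bounded_bilinear)

lemma lorentz_inner_commute: "x \<bullet>\<^sub>1 y = y \<bullet>\<^sub>1 x"
  by (simp add: lorentz_inner_def mult.commute)

lemma cross3_component_3: "cross3 x y $ 3 = x $ 1 * y $ 2 - x $ 2 * y $ 1"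
  by (simp add: cross3_def)

lemma lightlike_component_3_nonzero:
  assumes "lightlike_vector T"
  shows "T $ 3 \<noteq> 0"
proof
  assume "T $ 3 = 0"
  with assms have "(T $ 1)\<^sup>2 + (T $ 2)\<^sup>2 = 0"
    by (simp add: lightlike_vector_def lorentz_inner_def power2_eq_square)
  then have "T = 0"
    using \<open>T $ 3 = 0\<close> by (simp add: vec_eq_iff forall_3 sum_power2_eq_zero_iff)
  with assms show False
    by (simp add: lightlike_vector_def)
qed

text \<open>
  Lagrange's identity for the first two coordinates: \<open>T $ 3\<close> times the third coordinate
  of a vector orthogonal to \<open>T\<close> is the planar inner product with \<open>T\<close>, and
  \<open>(T $ 3)\<^sup>2 = (T $ 1)\<^sup>2 + (T $ 2)\<^sup>2\<close>.
\<close>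

lemma lorentz_inner_rank_one:
  assumes "lightlike_vector T" "T \<bullet>\<^sub>1 w = 0" "T \<bullet>\<^sub>1 x = 0"
  shows "(T $ 3)\<^sup>2 * (w \<bullet>\<^sub>1 x) = cross3 T w $ 3 * cross3 T x $ 3"
proof -
  have T: "T $ 3 * T $ 3 = T $ 1 * T $ 1 + T $ 2 * T $ 2"
    and w: "T $ 3 * w $ 3 = T $ 1 * w $ 1 + T $ 2 * w $ 2"
    and x: "T $ 3 * x $ 3 = T $ 1 * x $ 1 + T $ 2 * x $ 2"
    using assms by (simp_all add: lightlike_vector_def lorentz_inner_def)
  have "(T $ 3)\<^sup>2 * (w \<bullet>\<^sub>1 x) =
      (T $ 3 * T $ 3) * (w $ 1 * x $ 1 + w $ 2 * x $ 2) - (T $ 3 * w $ 3) * (T $ 3 * x $ 3)"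
    by (simp add: lorentz_inner_def power2_eq_square algebra_simps)
  also have "\<dots> = cross3 T w $ 3 * cross3 T x $ 3"
    unfolding T w x cross3_component_3 by (simp add: algebra_simps)
  finally show ?thesis .
qed

text \<open>
  Since \<open>T $ 3\<close> is nonzero, a vector of \<open>T\<^sup>\<bottom>\<close> is determined by its first two coordinates, so
  parallelism with \<open>T\<close> can be read off from the projection to that coordinate plane.
\<close>

lemma cross3_zero_iff_component_3:
  assumes "lightlike_vector T" "T \<bullet>\<^sub>1 w = 0"
  shows "cross3 T w = 0 \<longleftrightarrow> cross3 T w $ 3 = 0"
proof
  assume zero: "cross3 T w $ 3 = 0"
  have T: "T $ 3 * T $ 3 = T $ 1 * T $ 1 + T $ 2 * T $ 2"
    and w: "T $ 3 * w $ 3 = T $ 1 * w $ 1 + T $ 2 * w $ 2"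
    using assms by (simp_all add: lightlike_vector_def lorentz_inner_def)
  have "T $ 3 * (T $ 2 * w $ 3 - T $ 3 * w $ 2) = T $ 2 * (T $ 3 * w $ 3) - (T $ 3 * T $ 3) * w $ 2"
    by (simp add: algebra_simps)
  also have "\<dots> = - (T $ 1 * cross3 T w $ 3)"
    unfolding T w cross3_component_3 by (simp add: algebra_simps)
  finally have 1: "T $ 2 * w $ 3 - T $ 3 * w $ 2 = 0"
    using zero lightlike_component_3_nonzero[OF assms(1)] by simp
  have "T $ 3 * (T $ 3 * w $ 1 - T $ 1 * w $ 3) = (T $ 3 * T $ 3) * w $ 1 - T $ 1 * (T $ 3 * w $ 3)"
    by (simp add: algebra_simps)
  also have "\<dots> = - (T $ 2 * cross3 T w $ 3)"
    unfolding T w cross3_component_3 by (simp add: algebra_simps)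
  finally have 2: "T $ 3 * w $ 1 - T $ 1 * w $ 3 = 0"
    using zero lightlike_component_3_nonzero[OF assms(1)] by simp
  show "cross3 T w = 0"
    using 1 2 zero by (simp add: vec_eq_iff forall_3 cross3_def)
qed simp

lemma cross3_zero_if_null:
  assumes "lightlike_vector T" "T \<bullet>\<^sub>1 w = 0" "w \<bullet>\<^sub>1 w = 0"
  shows "cross3 T w = 0"
  using lorentz_inner_rank_one[OF assms(1,2,2)] assms cross3_zero_iff_component_3 by simp

lemma cross3_zero_iff_orthogonal_spacelike:
  assumes "lightlike_vector T" "T \<bullet>\<^sub>1 w = 0" "T \<bullet>\<^sub>1 x = 0" "x \<bullet>\<^sub>1 x > 0"
  shows "cross3 T w = 0 \<longleftrightarrow> w \<bullet>\<^sub>1 x = 0"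
proof -
  have T3: "(T $ 3)\<^sup>2 \<noteq> 0"
    using lightlike_component_3_nonzero[OF assms(1)] by simp
  have "cross3 T x $ 3 \<noteq> 0"
    using lorentz_inner_rank_one[OF assms(1,3,3)] assms(4) T3 by auto
  then show ?thesis
    using lorentz_inner_rank_one[OF assms(1-3)] T3 cross3_zero_iff_component_3[OF assms(1,2)]
    by (metis mult_eq_0_iff)
qed

lemma cross3_zero_imp_scaleR:
  assumes "cross3 v w = 0" "v \<noteq> 0"
  obtains a where "w = a *\<^sub>R v"
proof -
  have "collinear {0, v, w}"
    using assms(1) by (simp add: cross_eq_0)
  then show thesis
    using assms(2) that by (auto simp: collinear_lemma)
qed

section \<open>Derivatives within a parameter interval\<close>

lemma param_interval_at_within_nontrivial:
  assumes "param_interval I" "s \<in> I"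
  shows "at s within I \<noteq> bot"
proof -
  have "I \<noteq> {x}" for x
    using assms(1) by (auto simp: param_interval_def)
  then have "s islimpt I"
    using assms by (intro connected_imp_perfect) (auto simp: param_interval_def is_interval_connected)
  then show ?thesis
    by (simp add: trivial_limit_within)
qed

lemma C1_on_has_vector_derivative:
  assumes "C1_on I f" "s \<in> I"
  shows "(f has_vector_derivative velocity I f s) (at s within I)"
  using assms unfolding C1_on_def differentiable_on_def velocity_def
  by (simp add: vector_derivative_works)

lemma derivative_zero_if_locally_constant:
  assumes "param_interval I" "s \<in> I" "(f has_vector_derivative D) (at s within I)"
    and "0 < d" "\<And>t. t \<in> I \<Longrightarrow> dist t s < d \<Longrightarrow> f t = c"
  shows "D = 0"
proof -
  have "((\<lambda>t. c) has_vector_derivative D) (at s within I)"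
    by (rule has_vector_derivative_transform_within[OF assms(3,4,2)]) (use assms(5) in auto)
  then show ?thesis
    using vector_derivative_unique_within[OF param_interval_at_within_nontrivial[OF assms(1,2)]]
    by (metis has_vector_derivative_const)
qed

lemma derivative_zero_if_constant:
  assumes "param_interval I" "s \<in> I" "(f has_vector_derivative D) (at s within I)"
    and "\<And>t. t \<in> I \<Longrightarrow> f t = c"
  shows "D = 0"
  by (rule derivative_zero_if_locally_constant[OF assms(1-3) zero_less_one]) (use assms(4) in auto)

lemma constant_if_derivative_zero:
  assumes "param_interval I" "\<And>s. s \<in> I \<Longrightarrow> (f has_vector_derivative 0) (at s within I)"
  obtains c where "\<And>s. s \<in> I \<Longrightarrow> f s = c"
  using assms has_vector_derivative_zero_constant[of I f]
  by (metis is_interval_convex param_interval_def)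

lemma velocity_orthogonal_acceleration:
  assumes "param_interval I" "C2_on I \<alpha>" "lightlike_curve I \<alpha>" "s \<in> I"
  shows "velocity I \<alpha> s \<bullet>\<^sub>1 velocity I (velocity I \<alpha>) s = 0"
proof -
  have A: "(velocity I \<alpha> has_vector_derivative velocity I (velocity I \<alpha>) s) (at s within I)"
    using assms by (simp add: C2_on_def C1_on_has_vector_derivative)
  have "velocity I \<alpha> s \<bullet>\<^sub>1 velocity I (velocity I \<alpha>) s +
      velocity I (velocity I \<alpha>) s \<bullet>\<^sub>1 velocity I \<alpha> s = 0"
    by (rule derivative_zero_if_constant[OF assms(1,4)
          bounded_bilinear.has_vector_derivative[OF bounded_bilinear_lorentz_inner A A], where c = 0])
      (use assms(3) in \<open>auto simp: lightlike_curve_def lightlike_vector_def\<close>)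
  then show ?thesis
    by (simp add: lorentz_inner_commute)
qed

section \<open>Straight lines\<close>

text \<open>
  Normalising the velocity by its third coordinate removes the freedom of parametrization: the
  normalised velocity \<open>v\<close> is then constant, and \<open>\<alpha> - \<alpha>\<^sub>3 v\<close> is constant too.
\<close>

lemma straight_line_if_acceleration_parallel:
  fixes \<alpha> :: "real \<Rightarrow> real ^ 3"
  assumes I: "param_interval I" and C2: "C2_on I \<alpha>"
    and T3: "\<And>s. s \<in> I \<Longrightarrow> velocity I \<alpha> s $ 3 \<noteq> 0"
    and parallel: "\<And>s. s \<in> I \<Longrightarrow> cross3 (velocity I \<alpha> s) (velocity I (velocity I \<alpha>) s) = 0"
  shows "in_straight_line (\<alpha> ` I)"
proof -
  define T where "T = velocity I \<alpha>"
  define A where "A = velocity I T"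
  have dT: "(\<alpha> has_vector_derivative T s) (at s within I)" if "s \<in> I" for s
    using C2 that by (simp add: C2_on_def T_def C1_on_has_vector_derivative)
  have dA: "(T has_vector_derivative A s) (at s within I)" if "s \<in> I" for s
    using C2 that by (simp add: C2_on_def T_def A_def C1_on_has_vector_derivative)
  have d3: "((\<lambda>t. f t $ 3) has_real_derivative D $ 3) (at s within I)"
    if "(f has_vector_derivative D) (at s within I)" for f :: "real \<Rightarrow> real ^ 3" and D s
    using bounded_linear.has_vector_derivative[OF bounded_linear_vec_nth that]
    by (simp add: has_real_derivative_iff_has_vector_derivative)
  have "((\<lambda>t. inverse (T t $ 3) *\<^sub>R T t) has_vector_derivative 0) (at s within I)" if s: "s \<in> I" for s
  proof -
    have nz: "T s $ 3 \<noteq> 0"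
      using T3 s by (simp add: T_def)
    then have "T s \<noteq> 0"
      by auto
    moreover have "cross3 (T s) (A s) = 0"
      using parallel[OF s] by (simp add: T_def A_def)
    ultimately obtain a where a: "A s = a *\<^sub>R T s"
      using cross3_zero_imp_scaleR by blast
    have "((\<lambda>t. inverse (T t $ 3)) has_real_derivative
        - (inverse (T s $ 3) * A s $ 3 * inverse (T s $ 3))) (at s within I)"
      by (rule DERIV_inverse'[OF d3[OF dA[OF s]] nz])
    from has_vector_derivative_scaleR[OF this dA[OF s]] show ?thesis
      using nz by (simp add: a scaleR_left_diff_distrib[symmetric] mult.assoc)
  qed
  from constant_if_derivative_zero[OF I this]
  obtain v where v: "inverse (T s $ 3) *\<^sub>R T s = v" if "s \<in> I" for s
    by blast
  have Tv: "T s = T s $ 3 *\<^sub>R v" if "s \<in> I" for s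
    using v[OF that, symmetric] T3[OF that] by (simp add: T_def)
  have "((\<lambda>t. \<alpha> t - \<alpha> t $ 3 *\<^sub>R v) has_vector_derivative 0) (at s within I)" if s: "s \<in> I" for s
  proof -
    have "((\<lambda>t. \<alpha> t - \<alpha> t $ 3 *\<^sub>R v) has_vector_derivative
        T s - (\<alpha> s $ 3 *\<^sub>R 0 + T s $ 3 *\<^sub>R v)) (at s within I)"
      by (intro has_vector_derivative_diff has_vector_derivative_scaleR d3 dT s
          has_vector_derivative_const)
    then show ?thesis
      using Tv[OF s] by simp
  qed
  from constant_if_derivative_zero[OF I this]
  obtain p where p: "\<alpha> s - \<alpha> s $ 3 *\<^sub>R v = p" if "s \<in> I" for s
    by blast
  have "\<alpha> s = p + \<alpha> s $ 3 *\<^sub>R v" if "s \<in> I" for s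
    using p[OF that] by (simp add: algebra_simps)
  then have line: "\<alpha> ` I \<subseteq> {p + c *\<^sub>R v | c. True}"
    by blast
  obtain s where s: "s \<in> I"
    using I interior_subset by (fastforce simp: param_interval_def)
  have "v \<noteq> 0"
    using Tv[OF s] T3[OF s] by (auto simp: T_def)
  with line show ?thesis
    unfolding in_straight_line_def by blast
qed

text \<open>
  On the line \<open>p + \<real> v\<close> the product \<open>v \<times> \<alpha>\<close> is constant; differentiating it twice shows that velocity and acceleration are both multiples of
  the direction \<open>v\<close> of the line.
\<close>

lemma acceleration_parallel_if_straight_line:
  fixes \<alpha> :: "real \<Rightarrow> real ^ 3"
  assumes I: "param_interval I" and C2: "C2_on I \<alpha>" and line: "in_straight_line (\<alpha> ` I)"
    and s: "s \<in> I"
  shows "cross3 (velocity I \<alpha> s) (velocity I (velocity I \<alpha>) s) = 0"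
proof -
  obtain p v where "v \<noteq> 0" and sub: "\<alpha> ` I \<subseteq> {p + c *\<^sub>R v | c. True}"
    using line by (auto simp: in_straight_line_def)
  have d: "((\<lambda>t. cross3 v (f t)) has_vector_derivative cross3 v (velocity I f t)) (at t within I)"
    if "C1_on I f" "t \<in> I" for f t
    by (rule bounded_linear.has_vector_derivative[OF
          bounded_bilinear.bounded_linear_right[OF bounded_bilinear_cross3]
          C1_on_has_vector_derivative[OF that]])
  have T: "cross3 v (velocity I \<alpha> t) = 0" if t: "t \<in> I" for t
  proof (rule derivative_zero_if_constant[OF I t d[OF _ t]])
    show "cross3 v (\<alpha> u) = cross3 v p" if "u \<in> I" for u
      using sub that by (auto simp: image_subset_iff cross_add_right cross_mult_right)
  qed (use C2 in \<open>simp add: C2_on_def\<close>)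
  have A: "cross3 v (velocity I (velocity I \<alpha>) s) = 0"
    by (rule derivative_zero_if_constant[OF I s d[OF _ s] T]) (use C2 in \<open>simp_all add: C2_on_def\<close>)
  obtain a b where "velocity I \<alpha> s = a *\<^sub>R v" "velocity I (velocity I \<alpha>) s = b *\<^sub>R v"
    using cross3_zero_imp_scaleR[OF T[OF s] \<open>v \<noteq> 0\<close>] cross3_zero_imp_scaleR[OF A \<open>v \<noteq> 0\<close>] by metis
  then show ?thesis
    by (simp add: cross_mult_left cross_mult_right)
qed

lemma kappa1_zero_iff_acceleration_parallel:
  assumes "param_interval I" "C2_on I \<alpha>" "lightlike_curve I \<alpha>" "null_frame I \<alpha> z1 z2" "s \<in> I"
  shows "kappa1 I \<alpha> z1 s = 0 \<longleftrightarrow> cross3 (velocity I \<alpha> s) (velocity I (velocity I \<alpha>) s) = 0"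
proof -
  have "lightlike_vector (velocity I \<alpha> s)"
    using assms by (simp add: lightlike_curve_def)
  moreover have "velocity I \<alpha> s \<bullet>\<^sub>1 z1 s = 0" "z1 s \<bullet>\<^sub>1 z1 s > 0"
    using assms(4,5) by (simp_all add: null_frame_def)
  ultimately show ?thesis
    using cross3_zero_iff_orthogonal_spacelike velocity_orthogonal_acceleration[OF assms(1-3,5)]
    by (simp add: kappa1_def)
qed

section \<open>Curves on pseudo-spheres and light-cones\<close>

lemma
  assumes I: "param_interval I" and C2: "C2_on I \<alpha>" and ll: "lightlike_curve I \<alpha>"
    and quadric: "\<And>t. t \<in> I \<Longrightarrow> (\<alpha> t - P) \<bullet>\<^sub>1 (\<alpha> t - P) = k" and s: "s \<in> I"
  shows velocity_orthogonal_position: "velocity I \<alpha> s \<bullet>\<^sub>1 (\<alpha> s - P) = 0"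
    and acceleration_orthogonal_position: "velocity I (velocity I \<alpha>) s \<bullet>\<^sub>1 (\<alpha> s - P) = 0"
proof -
  have d: "((\<lambda>t. \<alpha> t - P) has_vector_derivative velocity I \<alpha> t) (at t within I)" if "t \<in> I" for t
    using C1_on_has_vector_derivative[of I \<alpha> t] C2 that
    by (simp add: C2_on_def has_vector_derivative_diff_const)
  have T: "velocity I \<alpha> t \<bullet>\<^sub>1 (\<alpha> t - P) = 0" if t: "t \<in> I" for t
  proof -
    have "(\<alpha> t - P) \<bullet>\<^sub>1 velocity I \<alpha> t + velocity I \<alpha> t \<bullet>\<^sub>1 (\<alpha> t - P) = 0"
      by (rule derivative_zero_if_constant[OF I t
            bounded_bilinear.has_vector_derivative[OF bounded_bilinear_lorentz_inner d[OF t] d[OF t]]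
            quadric])
    then show ?thesis
      by (simp add: lorentz_inner_commute)
  qed
  then show "velocity I \<alpha> s \<bullet>\<^sub>1 (\<alpha> s - P) = 0"
    using s .
  have dT: "(velocity I \<alpha> has_vector_derivative velocity I (velocity I \<alpha>) s) (at s within I)"
    using C2 s by (simp add: C2_on_def C1_on_has_vector_derivative)
  have "velocity I \<alpha> s \<bullet>\<^sub>1 velocity I \<alpha> s + velocity I (velocity I \<alpha>) s \<bullet>\<^sub>1 (\<alpha> s - P) = 0"
    by (rule derivative_zero_if_constant[OF I s
          bounded_bilinear.has_vector_derivative[OF bounded_bilinear_lorentz_inner dT d[OF s]] T])
  then show "velocity I (velocity I \<alpha>) s \<bullet>\<^sub>1 (\<alpha> s - P) = 0"
    using ll s by (simp add: lightlike_curve_def lightlike_vector_def)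
qed

lemma pseudo_sphere_acceleration_parallel:
  assumes "param_interval I" "C2_on I \<alpha>" "lightlike_curve I \<alpha>"
    and "r > 0" "\<alpha> ` I \<subseteq> pseudo_sphere P r" and s: "s \<in> I"
  shows "cross3 (velocity I \<alpha> s) (velocity I (velocity I \<alpha>) s) = 0"
proof -
  have quadric: "(\<alpha> t - P) \<bullet>\<^sub>1 (\<alpha> t - P) = r\<^sup>2" if "t \<in> I" for t
    using assms(5) that by (auto simp: pseudo_sphere_def)
  have "lightlike_vector (velocity I \<alpha> s)"
    using assms(3) s by (simp add: lightlike_curve_def)
  moreover have "(\<alpha> s - P) \<bullet>\<^sub>1 (\<alpha> s - P) > 0"
    using quadric[OF s] \<open>r > 0\<close> by simp
  ultimately show ?thesis
    using velocity_orthogonal_acceleration[OF assms(1-3) s]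
      velocity_orthogonal_position[OF assms(1-3) quadric s]
      acceleration_orthogonal_position[OF assms(1-3) quadric s]
    by (simp add: cross3_zero_iff_orthogonal_spacelike)
qed

lemma light_cone_acceleration_parallel:
  assumes I: "param_interval I" and C2: "C2_on I \<alpha>" and ll: "lightlike_curve I \<alpha>"
    and cone: "\<alpha> ` I \<subseteq> light_cone P" and s: "s \<in> I"
  shows "cross3 (velocity I \<alpha> s) (velocity I (velocity I \<alpha>) s) = 0"
proof (rule ccontr)
  define T where "T = velocity I \<alpha>"
  define A where "A = velocity I T"
  assume "cross3 (velocity I \<alpha> s) (velocity I (velocity I \<alpha>) s) \<noteq> 0"
  then have contra: "cross3 (T s) (A s) \<noteq> 0"
    by (simp add: T_def A_def)
  have quadric: "(\<alpha> t - P) \<bullet>\<^sub>1 (\<alpha> t - P) = 0" if "t \<in> I" for t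
    using cone that by (auto simp: light_cone_def)
  have d\<alpha>: "((\<lambda>t. \<alpha> t - P) has_vector_derivative T t) (at t within I)" if "t \<in> I" for t
    using C1_on_has_vector_derivative[of I \<alpha> t] C2 that
    by (simp add: C2_on_def T_def has_vector_derivative_diff_const)
  have dT: "(T has_vector_derivative A t) (at t within I)" if "t \<in> I" for t
    using C2 that by (simp add: C2_on_def T_def A_def C1_on_has_vector_derivative)
  have position: "cross3 (\<alpha> t - P) (T t) = 0" if t: "t \<in> I" for t
  proof -
    have "cross3 (T t) (\<alpha> t - P) = 0"
      using ll t velocity_orthogonal_position[OF I C2 ll quadric t] quadric[OF t]
      by (intro cross3_zero_if_null) (auto simp: lightlike_curve_def T_def)
    then show ?thesis
      by (metis cross_skew neg_equal_0_iff_equal)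
  qed
  have parallel: "cross3 (T t) (A t) = 0" if t: "t \<in> I" and away: "\<alpha> t - P \<noteq> 0" for t
  proof -
    have "cross3 (\<alpha> t - P) (A t) + cross3 (T t) (T t) = 0"
      by (rule derivative_zero_if_constant[OF I t
            bounded_bilinear.has_vector_derivative[OF bounded_bilinear_cross3 d\<alpha>[OF t] dT[OF t]]
            position])
    then have "cross3 (\<alpha> t - P) (A t) = 0"
      by simp
    then obtain a b where "T t = a *\<^sub>R (\<alpha> t - P)" "A t = b *\<^sub>R (\<alpha> t - P)"
      using cross3_zero_imp_scaleR[OF position[OF t] away] cross3_zero_imp_scaleR[OF _ away] by metis
    then show ?thesis
      by (simp only: cross_mult_left cross_mult_right cross_refl scaleR_zero_right)
  qed
  \<comment> \<open>If \<open>T \<times> A\<close> were nonzero at \<open>s\<close>, it would be nonzero near \<open>s\<close>, so the curve would stay at the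
    vertex there and its velocity at \<open>s\<close> would vanish.\<close>
  have cont: "continuous_on I (\<lambda>t. cross3 (T t) (A t))"
    using C2 by (intro continuous_on_cross)
      (auto simp: C2_on_def C1_on_def T_def A_def differentiable_imp_continuous_on)
  then obtain d where "d > 0"
    and near: "\<And>t. t \<in> I \<Longrightarrow> dist s t < d \<Longrightarrow> cross3 (T t) (A t) \<noteq> 0"
    using continuous_on_avoid[OF cont s contra] by blast
  have "T s = 0"
  proof (rule derivative_zero_if_locally_constant[OF I s d\<alpha>[OF s] \<open>d > 0\<close>])
    show "\<alpha> t - P = 0" if "t \<in> I" "dist t s < d" for t
      using parallel near that by (metis dist_commute)
  qed
  then show False
    using contra by simp
qed

theorem theorem4p5p3:
  fixes \<alpha> :: "real \<Rightarrow> real ^ 3" and I :: "real set" and P :: "real ^ 3" and r :: real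
  assumes "param_interval I"
    and "C2_on I \<alpha>"
    and "lightlike_curve I \<alpha>"
  shows "((r > 0 \<and> \<alpha> ` I \<subseteq> pseudo_sphere P r) \<or> \<alpha> ` I \<subseteq> light_cone P \<longrightarrow>
            (\<forall>z1 z2. null_frame I \<alpha> z1 z2 \<longrightarrow> (\<forall>s\<in>I. kappa1 I \<alpha> z1 s = 0)) \<and>
            in_straight_line (\<alpha> ` I)) \<and>
         (\<forall>z1 z2. null_frame I \<alpha> z1 z2 \<longrightarrow>
            ((\<forall>s\<in>I. kappa1 I \<alpha> z1 s = 0) \<longleftrightarrow> in_straight_line (\<alpha> ` I)))"
proof -
  let ?parallel = "\<forall>s\<in>I. cross3 (velocity I \<alpha> s) (velocity I (velocity I \<alpha>) s) = 0"
  have line: "in_straight_line (\<alpha> ` I) \<longleftrightarrow> ?parallel"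
  proof
    assume ?parallel
    moreover have "velocity I \<alpha> s $ 3 \<noteq> 0" if "s \<in> I" for s
      using assms(3) that lightlike_component_3_nonzero by (simp add: lightlike_curve_def)
    ultimately show "in_straight_line (\<alpha> ` I)"
      using straight_line_if_acceleration_parallel[OF assms(1,2)] by blast
  qed (use acceleration_parallel_if_straight_line[OF assms(1,2)] in blast)
  have curvature: "(\<forall>s\<in>I. kappa1 I \<alpha> z1 s = 0) \<longleftrightarrow> ?parallel" if "null_frame I \<alpha> z1 z2" for z1 z2
    using kappa1_zero_iff_acceleration_parallel[OF assms that] by blast
  have "?parallel" if "(r > 0 \<and> \<alpha> ` I \<subseteq> pseudo_sphere P r) \<or> \<alpha> ` I \<subseteq> light_cone P"
    using that pseudo_sphere_acceleration_parallel[OF assms] light_cone_acceleration_parallel[OF assms]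
    by blast
  with line curvature show ?thesis
    by blast
qed

end
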